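(* Let $b,m$ be integers with $b>1$ and $m>1$. The generalized Thue--Morse word $\mathbf{t}_{b,m}$ is a generalized pseudostandard word (over the alphabet $\mathbb{Z}_m$) if and only if $b\leq m$ or $b-1\equiv 0 \pmod m$.
   Context: The alphabet is $\mathcal{A}=\mathbb{Z}_m=\{0,1,\ldots,m-1\}$, and $\mathcal{A}^*$ is the free monoid of finite words over $\mathcal{A}$, with empty word $\varepsilon$. Generalized Thue--Morse word: for a base $b\ge 2$, $s_b(n)$ denotes the sum of the digits of the base-$b$ expansion of the nonnegative integer $n$, and $\mathbf{t}_{b,m}=\bigl(s_b(n) \bmod m\bigr)_{n=0}^\infty$, an infinite word over $\mathbb{Z}_m$. Involutory antimorphism: a map $\Psi:\mathcal{A}^*\to\mathcal{A}^*$ with $\Psi(uv)=\Psi(v)\Psi(u)$ for all $u,v\in\mathcal{A}^*$ and $\Psi^2=\mathrm{Id}$. Let $\mathcal{I}$ be the set of all involutory antimorphisms on $\mathcal{A}^*$. A finite word $w$ is a $\Psi$-palindrome if $\Psi(w)=w$. The $\Psi$-palindromic closure $w^\Psi$ of $w\in\mathcal{A}^*$ is the shortest $\Psi$-palindrome having $w$ as a prefix; equivalently, if $w=uq$ with $q$ the longest $\Psi$-palindromic suffix of $w$, then $w^\Psi=uq\Psi(u)$. Generalized pseudostandard word: given $\Theta=\vartheta_1\vartheta_2\vartheta_3\ldots\in\mathcal{I}^{\mathbb{N}}$ and $\Delta=\delta_1\delta_2\delta_3\ldots\in\mathcal{A}^{\mathbb{N}}$, put $w_0=\varepsilon$ and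 $w_n=(w_{n-1}\delta_n)^{\vartheta_n}$ for $n\geq 1$. Each $w_n$ is a prefix of $w_{n+1}$, and $\mathbf{u}_\Theta(\Delta)=\lim_{n\to\infty}w_n$ is the infinite word having every $w_n$ as a prefix. An infinite word is called a generalized pseudostandard word if it equals $\mathbf{u}_\Theta(\Delta)$ for some $\Theta\in\mathcal{I}^{\mathbb{N}}$ and some $\Delta\in\mathcal{A}^{\mathbb{N}}$. *)

theory Defs
  imports "HOL-Number_Theory.Cong" "HOL-Library.Sublist" "HOL-Library.FuncSet"
begin

fun digit_sum :: "nat \<Rightarrow> nat \<Rightarrow> nat" where
  "digit_sum b n = (if b < 2 \<or> n = 0 then 0 else n mod b + digit_sum b (n div b))"

declare digit_sum.simps [simp del]

definition thue_morse :: "nat \<Rightarrow> nat \<Rightarrow> nat \<Rightarrow> nat" where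
  "thue_morse b m n = digit_sum b n mod m"

text \<open>The free monoid over an alphabet \<open>A\<close> is \<open>lists A\<close>. A map on it is represented by a function on
  all lists, of which only the values on \<open>lists A\<close> matter.\<close>

definition involutory_antimorphism :: "'a set \<Rightarrow> ('a list \<Rightarrow> 'a list) \<Rightarrow> bool" where
  "involutory_antimorphism A \<Psi> \<longleftrightarrow>
     \<Psi> \<in> lists A \<rightarrow> lists A \<and>
     (\<forall>u\<in>lists A. \<forall>v\<in>lists A. \<Psi> (u @ v) = \<Psi> v @ \<Psi> u) \<and>
     (\<forall>u\<in>lists A. \<Psi> (\<Psi> u) = u)"

definition pseudopalindrome :: "'a set \<Rightarrow> ('a list \<Rightarrow> 'a list) \<Rightarrow> 'a list \<Rightarrow> bool" where
  "pseudopalindrome A \<Psi> w \<longleftrightarrow> w \<in> lists A \<and> \<Psi> w = w"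

text \<open>The shortest pseudopalindrome with prefix \<open>w\<close> is unique; see \<open>pal_closure_unique\<close>.\<close>

definition pal_closure :: "'a set \<Rightarrow> ('a list \<Rightarrow> 'a list) \<Rightarrow> 'a list \<Rightarrow> 'a list" where
  "pal_closure A \<Psi> w = (ARG_MIN length v. pseudopalindrome A \<Psi> v \<and> prefix w v)"

text \<open>The directive sequences are indexed from \<open>0\<close>, so that \<open>\<Theta> n\<close> and \<open>\<Delta> n\<close> stand for
  \<open>\<vartheta>\<close> and \<open>\<delta>\<close> with index \<open>n + 1\<close>.\<close>

fun pseudostandard_prefix ::
  "'a set \<Rightarrow> (nat \<Rightarrow> 'a list \<Rightarrow> 'a list) \<Rightarrow> (nat \<Rightarrow> 'a) \<Rightarrow> nat \<Rightarrow> 'a list" where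
  "pseudostandard_prefix A \<Theta> \<Delta> 0 = []"
| "pseudostandard_prefix A \<Theta> \<Delta> (Suc n) =
     pal_closure A (\<Theta> n) (pseudostandard_prefix A \<Theta> \<Delta> n @ [\<Delta> n])"

definition prefix_of_infinite :: "'a list \<Rightarrow> (nat \<Rightarrow> 'a) \<Rightarrow> bool" where
  "prefix_of_infinite w u \<longleftrightarrow> w = map u [0..<length w]"

text \<open>The limit exists and is unique; see \<open>pseudostandard_word_ex1\<close>.\<close>

definition pseudostandard_word ::
  "'a set \<Rightarrow> (nat \<Rightarrow> 'a list \<Rightarrow> 'a list) \<Rightarrow> (nat \<Rightarrow> 'a) \<Rightarrow> nat \<Rightarrow> 'a" where
  "pseudostandard_word A \<Theta> \<Delta> =
     (THE u. \<forall>n. prefix_of_infinite (pseudostandard_prefix A \<Theta> \<Delta> n) u)"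

definition generalized_pseudostandard :: "'a set \<Rightarrow> (nat \<Rightarrow> 'a) \<Rightarrow> bool" where
  "generalized_pseudostandard A u \<longleftrightarrow>
     (\<exists>\<Theta> \<Delta>. (\<forall>n. involutory_antimorphism A (\<Theta> n)) \<and> (\<forall>n. \<Delta> n \<in> A) \<and>
        u = pseudostandard_word A \<Theta> \<Delta>)"


lemma length_antimorphism_ge:
  assumes "involutory_antimorphism A \<Psi>" "w \<in> lists A"
  shows "length w \<le> length (\<Psi> w)"
  using assms(2)
proof (induction w)
  case (Cons a w)
  have a: "[a] \<in> lists A" and w: "w \<in> lists A" using Cons by auto
  have app: "\<Psi> (u @ v) = \<Psi> v @ \<Psi> u" if "u \<in> lists A" "v \<in> lists A" for u v
    using assms(1) that unfolding involutory_antimorphism_def by blast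
  have inv: "\<Psi> (\<Psi> u) = u" if "u \<in> lists A" for u
    using assms(1) that unfolding involutory_antimorphism_def by blast
  have "\<Psi> [] = \<Psi> [] @ \<Psi> []" using app[of "[]" "[]"] by simp
  then have "\<Psi> [] = []" by simp
  then have "\<Psi> [a] \<noteq> []" using inv[OF a] by fastforce
  then have "1 \<le> length (\<Psi> [a])" by (cases "\<Psi> [a]") auto
  moreover have "\<Psi> (a # w) = \<Psi> w @ \<Psi> [a]" using app[OF a w] by simp
  ultimately show ?case using Cons by simp
qed simp

lemma length_antimorphism:
  assumes "involutory_antimorphism A \<Psi>" "w \<in> lists A"
  shows "length (\<Psi> w) = length w"
proof -
  have "\<Psi> w \<in> lists A" "\<Psi> (\<Psi> w) = w"
    using assms unfolding involutory_antimorphism_def by blast+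
  then show ?thesis
    using length_antimorphism_ge[OF assms] length_antimorphism_ge[OF assms(1), of "\<Psi> w"] by simp
qed

lemma pal_closure_props:
  assumes "involutory_antimorphism A \<Psi>" "w \<in> lists A"
  shows "pseudopalindrome A \<Psi> (pal_closure A \<Psi> w)" "prefix w (pal_closure A \<Psi> w)"
    "\<And>v. pseudopalindrome A \<Psi> v \<Longrightarrow> prefix w v \<Longrightarrow> length (pal_closure A \<Psi> w) \<le> length v"
proof -
  have "pseudopalindrome A \<Psi> (w @ \<Psi> w) \<and> prefix w (w @ \<Psi> w)"
    using assms unfolding involutory_antimorphism_def pseudopalindrome_def Pi_def by simp
  then have "(pseudopalindrome A \<Psi> (pal_closure A \<Psi> w) \<and> prefix w (pal_closure A \<Psi> w)) \<and>
     (\<forall>v. pseudopalindrome A \<Psi> v \<and> prefix w v \<longrightarrow> length (pal_closure A \<Psi> w) \<le> length v)"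
    unfolding pal_closure_def by (rule arg_min_nat_lemma)
  then show "pseudopalindrome A \<Psi> (pal_closure A \<Psi> w)" "prefix w (pal_closure A \<Psi> w)"
    "\<And>v. pseudopalindrome A \<Psi> v \<Longrightarrow> prefix w v \<Longrightarrow> length (pal_closure A \<Psi> w) \<le> length v"
    by blast+
qed

lemma pal_closure_unique:
  assumes \<Psi>: "involutory_antimorphism A \<Psi>" and w: "w \<in> lists A"
    and v: "pseudopalindrome A \<Psi> v" "prefix w v"
    and min: "\<And>x. pseudopalindrome A \<Psi> x \<Longrightarrow> prefix w x \<Longrightarrow> length v \<le> length x"
  shows "v = pal_closure A \<Psi> w"
proof -
  let ?c = "pal_closure A \<Psi> w"
  note c = pal_closure_props[OF \<Psi> w]
  have len: "length v = length ?c" using min[OF c(1,2)] c(3)[OF v] by simp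
  have suf: "\<exists>t. x = t @ \<Psi> w" if x: "pseudopalindrome A \<Psi> x" "prefix w x" for x
  proof -
    obtain s where s: "x = w @ s" using x(2) by (auto simp: prefix_def)
    then have "s \<in> lists A" using x(1) by (auto simp: pseudopalindrome_def)
    then have "\<Psi> x = \<Psi> s @ \<Psi> w"
      using \<Psi> w s unfolding involutory_antimorphism_def by blast
    then show ?thesis using x(1) by (auto simp: pseudopalindrome_def)
  qed
  have "pseudopalindrome A \<Psi> (w @ \<Psi> w)"
    using \<Psi> w unfolding involutory_antimorphism_def pseudopalindrome_def Pi_def by simp
  then have le: "length v \<le> 2 * length w"
    using min[of "w @ \<Psi> w"] length_antimorphism[OF \<Psi> w] by simp
  obtain t1 t2 where t: "v = t1 @ \<Psi> w" "?c = t2 @ \<Psi> w"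
    using suf[OF v] suf[OF c(1,2)] by blast
  obtain s1 s2 where s: "v = w @ s1" "?c = w @ s2"
    using v(2) c(2) unfolding prefix_def by blast
  note e = s(1) t(1) s(2) t(2)
  have lt: "length t1 = length t2" "length t1 \<le> length w"
    using len le e(2,4) length_antimorphism[OF \<Psi> w]
    by (metis add_right_cancel length_append, metis add_le_cancel_right length_append mult_2)
  have "t1 = take (length t1) v" "t2 = take (length t1) ?c"
    using e(2,4) lt(1) by (metis append_eq_conv_conj)+
  moreover have "take (length t1) v = take (length t1) w" "take (length t1) ?c = take (length t1) w"
    using e(1,3) lt(2) by simp_all
  ultimately show ?thesis using e by metis
qed

lemma pal_closure_eq_suffix:
  assumes \<Psi>: "involutory_antimorphism A \<Psi>" and w: "u @ q \<in> lists A"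
    and q: "pseudopalindrome A \<Psi> q"
    and longest: "\<And>q'. pseudopalindrome A \<Psi> q' \<Longrightarrow> suffix q' (u @ q) \<Longrightarrow> length q' \<le> length q"
  shows "pal_closure A \<Psi> (u @ q) = u @ q @ \<Psi> u"
proof (rule pal_closure_unique[OF \<Psi> w, symmetric])
  have app: "\<Psi> (x @ y) = \<Psi> y @ \<Psi> x" if "x \<in> lists A" "y \<in> lists A" for x y
    using \<Psi> that unfolding involutory_antimorphism_def by blast
  have cl: "\<Psi> x \<in> lists A" "\<Psi> (\<Psi> x) = x" if "x \<in> lists A" for x
    using \<Psi> that unfolding involutory_antimorphism_def by blast+
  have uq: "u \<in> lists A" "q \<in> lists A" using w by auto
  have "\<Psi> (u @ (q @ \<Psi> u)) = u @ q @ \<Psi> u"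
    using app[of u "q @ \<Psi> u"] app[of q "\<Psi> u"] cl uq q
    by (simp add: pseudopalindrome_def)
  then show "pseudopalindrome A \<Psi> (u @ q @ \<Psi> u)"
    using uq cl by (simp add: pseudopalindrome_def)
  show "prefix (u @ q) (u @ q @ \<Psi> u)" by simp
  fix x assume x: "pseudopalindrome A \<Psi> x" "prefix (u @ q) x"
  show "length (u @ q @ \<Psi> u) \<le> length x"
  proof (rule ccontr)
    assume "\<not> ?thesis"
    then have short: "length x < 2 * length u + length q"
      using length_antimorphism[OF \<Psi> uq(1)] by simp
    obtain s where s: "x = (u @ q) @ s" using x(2) by (auto simp: prefix_def)
    have sA: "s \<in> lists A" using x(1) s by (auto simp: pseudopalindrome_def)
    have ls: "length (\<Psi> s) = length s" by (rule length_antimorphism[OF \<Psi> sA])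
    have x2: "x = \<Psi> s @ \<Psi> (u @ q)"
      using app[OF w sA] x(1) s by (simp add: pseudopalindrome_def)
    have lsu: "length s < length u" using short s by simp
    define q' where "q' = drop (length s) (u @ q)"
    have "take (length s) x = \<Psi> s" using x2 ls by simp
    moreover have "take (length s) x = take (length s) (u @ q)" using s lsu by simp
    ultimately have uqs: "u @ q = \<Psi> s @ q'"
      unfolding q'_def by (metis append_take_drop_id)
    have q'A: "q' \<in> lists A" using w uqs by (metis append_in_lists_conv)
    have "\<Psi> (u @ q) = \<Psi> q' @ s" using uqs app[OF cl(1)[OF sA] q'A] cl(2)[OF sA] by simp
    then have "\<Psi> s @ \<Psi> q' @ s = \<Psi> s @ q' @ s" using s x2 uqs by simp
    then have "pseudopalindrome A \<Psi> q'" using q'A by (simp add: pseudopalindrome_def)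
    moreover have "suffix q' (u @ q)" using uqs by (simp add: suffix_def)
    ultimately have "length q' \<le> length q" by (rule longest)
    then show False using lsu by (simp add: q'_def)
  qed
qed

lemma pseudostandard_word_ex1:
  assumes "\<forall>n. involutory_antimorphism A (\<Theta> n)" "\<forall>n. \<Delta> n \<in> A"
  shows "\<exists>!u. \<forall>n. prefix_of_infinite (pseudostandard_prefix A \<Theta> \<Delta> n) u"
proof -
  let ?w = "pseudostandard_prefix A \<Theta> \<Delta>"
  have wA: "?w n \<in> lists A" for n
  proof (induction n)
    case (Suc n)
    then have "?w n @ [\<Delta> n] \<in> lists A" using assms(2) by simp
    then have "pseudopalindrome A (\<Theta> n) (?w (Suc n))"
      using pal_closure_props(1) assms(1) by fastforce
    then show ?case by (simp only: pseudopalindrome_def)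
  qed simp
  have pre: "prefix (?w n @ [\<Delta> n]) (?w (Suc n))" for n
    using pal_closure_props(2)[of A "\<Theta> n" "?w n @ [\<Delta> n]"] assms wA[of n] by simp
  have len: "n \<le> length (?w n)" for n
  proof (induction n)
    case (Suc n)
    then show ?case using prefix_length_le[OF pre[of n]] by (simp del: pseudostandard_prefix.simps)
  qed simp
  have step: "prefix (?w n) (?w (Suc n))" for n
    using pre[of n] by (metis append_prefixD)
  have mono: "prefix (?w i) (?w j)" if "i \<le> j" for i j
    using that by (induction j rule: dec_induct) (auto intro: prefix_order.trans step
        simp del: pseudostandard_prefix.simps)
  show ?thesis
  proof (rule ex1I[of _ "\<lambda>i. ?w (Suc i) ! i"])
    show "\<forall>n. prefix_of_infinite (?w n) (\<lambda>i. ?w (Suc i) ! i)"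
      unfolding prefix_of_infinite_def
    proof (intro allI nth_equalityI)
      fix n i assume i: "i < length (?w n)"
      have "i < length (?w (Suc i))" using len[of "Suc i"] by simp
      then have "?w n ! i = ?w (Suc i) ! i"
        using mono[of n "Suc i"] mono[of "Suc i" n] i
        by (metis nat_le_linear nth_append prefix_def)
      then show "?w n ! i = map (\<lambda>i. ?w (Suc i) ! i) [0..<length (?w n)] ! i" using i by simp
    qed simp
    fix u assume u: "\<forall>n. prefix_of_infinite (?w n) u"
    show "u = (\<lambda>i. ?w (Suc i) ! i)"
    proof
      fix i
      have "?w (Suc i) = map u [0..<length (?w (Suc i))]"
        using u unfolding prefix_of_infinite_def by blast
      moreover have "i < length (?w (Suc i))" using len[of "Suc i"] by simp
      ultimately show "u i = ?w (Suc i) ! i"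
        by (metis add_0 diff_zero length_upt nth_map nth_upt)
    qed
  qed
qed

end

theory Submission imports Defs begin

text \<open>Write \<open>s\<close> for the digit sum, \<open>t\<close> for the Thue--Morse word and \<open>R_k\<close> for the antimorphism that
  reverses a word and replaces each letter \<open>x\<close> by \<open>k - x\<close> modulo \<open>m\<close>.

  Complementing all digits shows that for \<open>1 \<le> k \<le> b\<close> the prefix of \<open>t\<close> of length \<open>k * b ^ e\<close> is
  fixed by \<open>R_n\<close> with \<open>n = e * (b - 1) + (k - 1)\<close> (\<open>digit_sum_complement\<close>). These lengths, in
  increasing order, are \<open>1, 2, \<dots>, b, 2 * b, \<dots>, b\<^sup>2, 2 * b\<^sup>2, \<dots>\<close>, and \<open>n\<close> is the position
  in this list, counted from \<open>0\<close>. If \<open>b \<le> m\<close>, each of these prefixes is the \<open>R_n\<close>-palindromic closure of the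
  preceding one extended by a letter: a shorter closure would require the prefix of length
  \<open>b ^ e + 1\<close> to end in a copy, at least two letters long, of a prefix of \<open>t\<close> with \<open>1\<close> added
  to every letter, and \<open>no_shifted_prefix_at_end\<close> excludes that by descent on \<open>e\<close>. If \<open>m\<close> divides \<open>b - 1\<close>, then
  \<open>t = (0 1 \<dots> m-1)\<^sup>\<omega>\<close>, because \<open>s n\<close> is congruent to \<open>n\<close> modulo \<open>b - 1\<close>. Then every prefix is
  fixed by some \<open>R_n\<close> and is its own closure.

  Now let \<open>m < b\<close> with \<open>m\<close> not dividing \<open>b - 1\<close>, and suppose that \<open>t\<close> is the limit of words \<open>w_n\<close>
  built by closures. Let \<open>B = b ^ m\<close>, so that \<open>s (B - 1) = m * (b - 1)\<close> is \<open>0\<close> modulo \<open>m\<close>. One of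
  the closure steps passes from a length at most \<open>B\<close> to a length \<open>L > B\<close>; as closure at most
  doubles the length, \<open>L \<le> 2 * B + 2\<close>. The places where \<open>t\<close> fails to have period \<open>m\<close> are
  preserved by a pseudopalindromic symmetry, so \<open>b\<close> divides the length of every pseudopalindromic
  prefix longer than \<open>b\<close> (\<open>thue_morse_mirrored_dvd\<close>), and dividing the length by \<open>b\<close> gives another
  prefix with such a symmetry (\<open>thue_morse_mirrored_div\<close>). Iterating this forces \<open>L = 2 * B\<close>, and then the
  antimorphism used in this step is \<open>R_1\<close>. But the prefix of length \<open>B + 1\<close> ends in
  \<open>0 1 \<dots> m-1 0 1\<close>, which is fixed by \<open>R_1\<close>, so the closure has length at most \<open>2 * B - m\<close>, a
  contradiction.\<close>

section \<open>Digit sums\<close>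

lemma digit_sum_0 [simp]: "digit_sum b 0 = 0"
  by (simp add: digit_sum.simps)

lemma digit_sum_mult_add:
  assumes "b > 1" "r < b"
  shows "digit_sum b (a * b + r) = digit_sum b a + r"
  using assms by (subst digit_sum.simps) auto

lemma digit_sum_mult: "b > 1 \<Longrightarrow> digit_sum b (a * b) = digit_sum b a"
  using digit_sum_mult_add[of b 0 a] by simp

lemma digit_sum_digit: "b > 1 \<Longrightarrow> r < b \<Longrightarrow> digit_sum b r = r"
  using digit_sum_mult_add[of b r 0] by simp

lemma digit_sum_power_add:
  assumes "b > 1" "x < b ^ e"
  shows "digit_sum b (k * b ^ e + x) = digit_sum b k + digit_sum b x"
  using assms(2)
proof (induction e arbitrary: x)
  case (Suc e)
  define a r where "a = x div b" and "r = x mod b"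
  have r: "r < b" and x: "x = a * b + r" using assms(1) by (simp_all add: a_def r_def)
  have "a < b ^ e" using Suc.prems assms(1) by (simp add: a_def div_less_iff_less_mult mult.commute)
  moreover have "k * b ^ Suc e + x = (k * b ^ e + a) * b + r" by (simp add: x algebra_simps)
  ultimately show ?case
    using Suc.IH r assms(1) by (simp only: x digit_sum_mult_add)
qed simp

text \<open>The digits of \<open>k * b ^ e - 1\<close> are \<open>k - 1\<close> followed by \<open>e\<close> times the largest digit \<open>b - 1\<close>, so
  subtracting \<open>j\<close> involves no borrowing. In terms of the Thue--Morse word, its prefix of length
  \<open>k * b ^ e\<close> is fixed by a reflection.\<close>

lemma digit_sum_complement:
  assumes b: "b > 1" and k: "0 < k" "k \<le> b" and "j < k * b ^ e"
  shows "digit_sum b j + digit_sum b (k * b ^ e - 1 - j) = e * (b - 1) + (k - 1)"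
  using assms(4)
proof (induction e arbitrary: j)
  case 0
  then show ?case using b k by (simp add: digit_sum_digit)
next
  case (Suc e)
  define a r where "a = j div b" and "r = j mod b"
  have r: "r < b" and j: "j = a * b + r" using b by (simp_all add: a_def r_def)
  have a: "a < k * b ^ e"
    using Suc.prems b by (simp add: a_def div_less_iff_less_mult mult_ac)
  define a' where "a' = k * b ^ e - 1 - a"
  have "k * b ^ e = a + a' + 1" using a by (simp add: a'_def)
  then have "k * b ^ Suc e = (a + a' + 1) * b" by (metis mult.assoc power_Suc2)
  then have "k * b ^ Suc e - 1 - j = a' * b + (b - 1 - r)" using r by (simp add: j algebra_simps)
  then have "digit_sum b (k * b ^ Suc e - 1 - j) = digit_sum b a' + (b - 1 - r)"
    using digit_sum_mult_add[OF b, of "b - 1 - r" a'] b by simp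
  moreover have "digit_sum b j = digit_sum b a + r" using b r by (simp add: j digit_sum_mult_add)
  moreover have "digit_sum b a + digit_sum b a' = e * (b - 1) + (k - 1)"
    using Suc.IH[OF a] by (simp add: a'_def)
  moreover have "Suc e * (b - 1) = e * (b - 1) + (b - 1)" by simp
  ultimately show ?case using r by linarith
qed

text \<open>Casting out \<open>b - 1\<close>.\<close>

lemma digit_sum_cong:
  assumes b: "b > 1"
  shows "[digit_sum b n = n] (mod (b - 1))"
proof (induction n rule: less_induct)
  case (less n)
  show ?case
  proof (cases "n = 0")
    case False
    then have "[digit_sum b (n div b) = n div b] (mod (b - 1))" using less b by simp
    moreover have "n div b * b = n div b + n div b * (b - 1)"
      using b by (simp add: algebra_simps)
    then have "[n div b = n div b * b] (mod (b - 1))" by (simp add: cong_def)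
    ultimately have "[digit_sum b (n div b) + n mod b = n div b * b + n mod b] (mod (b - 1))"
      by (meson cong_add cong_refl cong_trans)
    then show ?thesis using digit_sum_mult_add[of b "n mod b" "n div b"] b by simp
  qed simp
qed

lemma thue_morse_less: "m > 0 \<Longrightarrow> thue_morse b m n < m"
  by (simp add: thue_morse_def)

lemma thue_morse_eq_iff: "thue_morse b m i = thue_morse b m j \<longleftrightarrow> [digit_sum b i = digit_sum b j] (mod m)"
  by (simp add: thue_morse_def cong_def)

section \<open>Antimorphisms as reversed letter maps\<close>

text \<open>Length preservation makes the image of a one-letter word a one-letter word, so taking its head
  loses nothing.\<close>

definition letter_map :: "('a list \<Rightarrow> 'a list) \<Rightarrow> 'a \<Rightarrow> 'a" where
  "letter_map \<Psi> a = hd (\<Psi> [a])"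

text \<open>Antimorphisms map letters to letters, as they preserve lengths, and words are products of
  letters.\<close>

lemma antimorphism_eq_rev_map:
  assumes \<Psi>: "involutory_antimorphism A \<Psi>" and "w \<in> lists A"
  shows "\<Psi> w = rev (map (letter_map \<Psi>) w)"
  using assms(2)
proof (induction w)
  case Nil
  then show ?case using length_antimorphism[OF \<Psi>, of "[]"] by simp
next
  case (Cons a w)
  then have a: "[a] \<in> lists A" and w: "w \<in> lists A" by auto
  have "length (\<Psi> [a]) = 1" using length_antimorphism[OF \<Psi> a] by simp
  then have "\<Psi> [a] = [letter_map \<Psi> a]"
    by (cases "\<Psi> [a]") (auto simp: letter_map_def)
  moreover have "\<Psi> ([a] @ w) = \<Psi> w @ \<Psi> [a]"
    using \<Psi> a w unfolding involutory_antimorphism_def by blast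
  ultimately show ?case using Cons by simp
qed

lemma rev_map_eq_iff:
  "rev (map f w) = w \<longleftrightarrow> (\<forall>i<length w. f (w ! (length w - 1 - i)) = w ! i)"
proof -
  have "rev (map f w) ! i = f (w ! (length w - 1 - i))" if "i < length w" for i
    using that by (simp add: rev_nth)
  then show ?thesis unfolding list_eq_iff_nth_eq by auto
qed

lemma pseudopalindrome_iff:
  assumes "involutory_antimorphism A \<Psi>"
  shows "pseudopalindrome A \<Psi> w \<longleftrightarrow> w \<in> lists A \<and>
    (\<forall>i<length w. letter_map \<Psi> (w ! (length w - 1 - i)) = w ! i)"
proof (cases "w \<in> lists A")
  case True
  then show ?thesis
    unfolding pseudopalindrome_def antimorphism_eq_rev_map[OF assms True] rev_map_eq_iff by simp
qed (simp add: pseudopalindrome_def)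

definition reflection :: "nat \<Rightarrow> nat \<Rightarrow> nat \<Rightarrow> nat" where
  "reflection m s x = nat ((int s - int x) mod int m)"

text \<open>The symmetric form of the right-hand side is what makes reflections involutions and lets
  the palindrome condition be checked by adding digit sums.\<close>

lemma reflection_eq_iff:
  assumes "y < m"
  shows "reflection m s x = y \<longleftrightarrow> [x + y = s] (mod m)"
proof -
  have "reflection m s x = y \<longleftrightarrow> (int s - int x) mod int m = int y mod int m"
    using assms by (auto simp: reflection_def)
  also have "\<dots> \<longleftrightarrow> int m dvd int s - int (x + y)"
    by (simp add: mod_eq_dvd_iff diff_diff_eq)
  also have "\<dots> \<longleftrightarrow> [int (x + y) = int s] (mod int m)"
    by (simp only: cong_iff_dvd_diff dvd_diff_commute)
  finally show ?thesis by (simp only: cong_int_iff)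
qed

lemma reflection_less: "m > 0 \<Longrightarrow> reflection m s x < m"
  by (simp add: reflection_def nat_less_iff)

lemma involutory_antimorphism_reflection:
  assumes "m > 0"
  shows "involutory_antimorphism {0..<m} (\<lambda>w. rev (map (reflection m s) w))"
proof -
  have "reflection m s (reflection m s x) = x" if "x < m" for x
    using reflection_eq_iff[OF reflection_less[OF assms], of s x s x] reflection_eq_iff[OF that]
    by (simp add: add.commute)
  then have "map (reflection m s \<circ> reflection m s) u = u" if "u \<in> lists {0..<m}" for u
    using that by (auto intro!: map_idI)
  then show ?thesis
    using reflection_less[OF assms] by (auto simp: involutory_antimorphism_def rev_map)
qed

lemma pseudopalindrome_reflection_iff:
  "pseudopalindrome {0..<m} (\<lambda>w. rev (map (reflection m s) w)) w \<longleftrightarrow>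
    w \<in> lists {0..<m} \<and> (\<forall>i<length w. [w ! (length w - 1 - i) + w ! i = s] (mod m))"
proof -
  have "w ! i < m" if "w \<in> lists {0..<m}" "i < length w" for i
    using that nth_mem by fastforce
  then show ?thesis
    unfolding pseudopalindrome_def rev_map_eq_iff by (auto simp: reflection_eq_iff)
qed

section \<open>Sufficiency\<close>

lemma prefix_map_upt:
  assumes "k \<le> l"
  shows "prefix (map f [0..<k]) (map f [0..<l])"
proof -
  have "[0..<l] = [0..<k] @ [k..<l]" using upt_add_eq_append[of 0 k "l - k"] assms by simp
  then show ?thesis by simp
qed

text \<open>To exhibit an infinite word as generalized pseudostandard it suffices to name the lengths of the
  intermediate words: the directive letter is then the letter of \<open>u\<close> at the position reached, and
  each closure is identified by being a pseudopalindrome of minimal length.\<close>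

lemma generalized_pseudostandardI:
  assumes \<Theta>: "\<And>n. involutory_antimorphism A (\<Theta> n)" and u: "\<And>i. u i \<in> A"
    and 0: "len 0 = 0"
    and less: "\<And>n. len n < len (Suc n)"
    and pal: "\<And>n. pseudopalindrome A (\<Theta> n) (map u [0..<len (Suc n)])"
    and min: "\<And>n v. pseudopalindrome A (\<Theta> n) v \<Longrightarrow> prefix (map u [0..<Suc (len n)]) v \<Longrightarrow>
        len (Suc n) \<le> length v"
  shows "generalized_pseudostandard A u"
proof -
  define \<Delta> where "\<Delta> n = u (len n)" for n
  have pre: "pseudostandard_prefix A \<Theta> \<Delta> n = map u [0..<len n]" for n
  proof (induction n)
    case (Suc n)
    have "prefix (map u [0..<Suc (len n)]) (map u [0..<len (Suc n)])"
      using less[of n] by (intro prefix_map_upt) simp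
    moreover have "map u [0..<Suc (len n)] \<in> lists A" using u by auto
    ultimately have "map u [0..<len (Suc n)] = pal_closure A (\<Theta> n) (map u [0..<Suc (len n)])"
      using min[of n]
      by (intro pal_closure_unique[OF \<Theta> _ pal]) (simp_all only: length_map length_upt diff_zero)
    then show ?case using Suc by (simp add: \<Delta>_def)
  qed (simp add: 0)
  have ex: "\<exists>!x. \<forall>n. prefix_of_infinite (pseudostandard_prefix A \<Theta> \<Delta> n) x"
    using \<Theta> u by (intro pseudostandard_word_ex1) (auto simp: \<Delta>_def)
  have lim_u: "\<forall>n. prefix_of_infinite (pseudostandard_prefix A \<Theta> \<Delta> n) u"
    by (simp add: pre prefix_of_infinite_def)
  have lim: "\<forall>n. prefix_of_infinite (pseudostandard_prefix A \<Theta> \<Delta> n) (pseudostandard_word A \<Theta> \<Delta>)"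
    unfolding pseudostandard_word_def by (rule theI'[OF ex])
  obtain x where "\<And>y. \<forall>n. prefix_of_infinite (pseudostandard_prefix A \<Theta> \<Delta> n) y \<Longrightarrow> y = x"
    using ex by (elim ex1E) blast
  from this[OF lim_u] this[OF lim] have "u = pseudostandard_word A \<Theta> \<Delta>" by simp
  moreover have "\<Delta> n \<in> A" for n using u by (simp add: \<Delta>_def)
  ultimately show ?thesis
    unfolding generalized_pseudostandard_def
    by (intro exI[of _ \<Theta>] exI[of _ \<Delta>] conjI allI \<Theta>)
qed

lemma thue_morse_prefix_pal:
  assumes "m > 0"
    and "\<And>i. i < l \<Longrightarrow> [digit_sum b (l - 1 - i) + digit_sum b i = s] (mod m)"
  shows "pseudopalindrome {0..<m} (\<lambda>w. rev (map (reflection m s) w)) (map (thue_morse b m) [0..<l])"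
  using assms
  by (auto simp: pseudopalindrome_reflection_iff thue_morse_less thue_morse_def cong_def mod_add_eq)

text \<open>Here the letter at \<open>n\<close> is \<open>n\<close> modulo \<open>m\<close>, so the prefix of length \<open>n + 1\<close> is already fixed by the
  reflection \<open>x \<mapsto> n - x\<close> and each closure adds nothing.\<close>

lemma thue_morse_periodic_pseudostandard:
  assumes b: "b > 1" and m: "m > 1" and cong: "[b - 1 = 0] (mod m)"
  shows "generalized_pseudostandard {0..<m} (thue_morse b m)"
proof (rule generalized_pseudostandardI[where
      \<Theta> = "\<lambda>n w. rev (map (reflection m n) w)" and len = "\<lambda>n. n"])
  have s: "[digit_sum b n = n] (mod m)" for n
    using digit_sum_cong[OF b] cong by (auto simp: cong_0_iff intro: cong_dvd_modulus_nat)
  show "pseudopalindrome {0..<m} (\<lambda>w. rev (map (reflection m n) w))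
      (map (thue_morse b m) [0..<Suc n])" for n
  proof (rule thue_morse_prefix_pal)
    fix i assume "i < Suc n"
    then show "[digit_sum b (Suc n - 1 - i) + digit_sum b i = n] (mod m)"
      using cong_add[OF s[of "n - i"] s[of i]] by simp
  qed (use m in simp)
  show "Suc n \<le> length v" if "prefix (map (thue_morse b m) [0..<Suc n]) v" for n v
    using prefix_length_le[OF that] by simp
qed (use m in \<open>auto intro: involutory_antimorphism_reflection thue_morse_less\<close>)

text \<open>If \<open>b\<close> divides the offset \<open>c\<close>, looking only at multiples of \<open>b\<close> gives the same situation for
  \<open>c div b\<close> and \<open>e - 1\<close>. Otherwise the last digit \<open>d\<close> of \<open>c\<close> is positive, and the carries in \<open>c + r\<close>
  and in \<open>r\<close> happen at different \<open>r\<close>. If the first carry after \<open>c\<close> leads to \<open>b ^ e\<close>, the digit sum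
  there is \<open>1\<close>, but \<open>1 + (b - d)\<close> is expected. If not, the step from \<open>r = b - 1\<close> to \<open>r = b\<close>
  increases the digit sum of \<open>c + r\<close> by \<open>1\<close> and changes that of \<open>r\<close> by \<open>2 - b\<close>. Since \<open>b \<le> m\<close>,
  neither \<open>b - d\<close> nor \<open>b - 1\<close> is \<open>0\<close> modulo \<open>m\<close>.\<close>

lemma no_shifted_prefix_at_end:
  assumes b: "b > 1" and bm: "b \<le> m"
    and "0 < c" "c < b ^ e"
    and "\<And>r. r \<le> b ^ e - c \<Longrightarrow> [digit_sum b (c + r) = 1 + digit_sum b r] (mod m)"
  shows False
  using assms(3-)
proof (induction e arbitrary: c)
  case (Suc e)
  define a d where "a = c div b" and "d = c mod b"
  have d: "d < b" and c: "c = a * b + d" using b by (simp_all add: a_def d_def)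
  show False
  proof (cases "d = 0")
    case True
    show False
    proof (rule Suc.IH[of a])
      show "0 < a" using Suc.prems(1) c True by (cases a) auto
      show "a < b ^ e" using Suc.prems(2) b c True by (simp add: mult.commute)
      fix r assume "r \<le> b ^ e - a"
      then have "r * b \<le> (b ^ e - a) * b" by simp
      then have "r * b \<le> b ^ Suc e - c" by (simp add: c True algebra_simps)
      from Suc.prems(3)[OF this] show "[digit_sum b (a + r) = 1 + digit_sum b r] (mod m)"
        using b digit_sum_mult[of b "a + r"] digit_sum_mult[of b r] by (simp add: c True distrib_right)
    qed
  next
    case False
    have "a * b < b ^ e * b" using Suc.prems(2) unfolding c power_Suc2 by linarith
    then have a: "Suc a \<le> b ^ e" using b by simp
    show False
    proof (cases "Suc a = b ^ e")
      case True
      then have B: "b ^ Suc e = Suc a * b" by (simp add: mult.commute)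
      have "[digit_sum b (c + (b - d)) = 1 + digit_sum b (b - d)] (mod m)"
      proof (rule Suc.prems(3))
        show "b - d \<le> b ^ Suc e - c" unfolding B c by simp
      qed
      moreover have "c + (b - d) = Suc a * b" using d by (simp add: c)
      moreover have "digit_sum b (Suc a * b) = 1"
        using digit_sum_power_add[of b 0 "Suc e" 1] b unfolding B[symmetric]
        by (simp add: digit_sum_digit)
      ultimately have "[1 = 1 + (b - d)] (mod m)" using b False by (simp add: digit_sum_digit)
      then have "[b - d = 0] (mod m)"
        by (metis add.right_neutral cong_add_lcancel_nat cong_sym)
      then show False using d False bm by (auto simp: cong_0_iff dest: dvd_imp_le)
    next
      case ne: False
      then have "Suc (Suc a) * b \<le> b ^ e * b" using a by (intro mult_le_mono1) simp
      then have le: "b \<le> b ^ Suc e - c" using d by (simp add: c algebra_simps)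
      have "[digit_sum b (c + b) = 1 + digit_sum b b] (mod m)" using le by (rule Suc.prems(3))
      moreover have "[digit_sum b (c + (b - 1)) = 1 + digit_sum b (b - 1)] (mod m)"
        by (rule Suc.prems(3)) (use le in simp)
      moreover have "digit_sum b (c + b) = digit_sum b (Suc a) + (d - 1) + 1"
        using digit_sum_mult_add[OF b d, of "Suc a"] False by (simp add: c add_ac)
      moreover have "digit_sum b (c + (b - 1)) = digit_sum b (Suc a) + (d - 1)"
      proof -
        have "c + (b - 1) = Suc a * b + (d - 1)" using False b by (simp add: c)
        then show ?thesis using digit_sum_mult_add[OF b, of "d - 1" "Suc a"] d by simp
      qed
      moreover have "digit_sum b b = 1"
        using digit_sum_mult[of b 1] b by (simp add: digit_sum_digit)
      moreover have "digit_sum b (b - 1) = b - 1" using b by (simp add: digit_sum_digit)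
      ultimately have "[digit_sum b (Suc a) + (d - 1) + 1 = 1 + 1] (mod m)"
        and "[digit_sum b (Suc a) + (d - 1) = 1 + (b - 1)] (mod m)" by simp_all
      then have "[1 + (b - 1) + 1 = 1 + 1] (mod m)"
        by (meson cong_add_rcancel_nat cong_sym cong_trans)
      then have "[b - 1 + 2 = 0 + 2] (mod m)" by (simp add: add_ac)
      then have "[b - 1 = 0] (mod m)" by (simp only: cong_add_rcancel_nat)
      then show False using b bm by (auto simp: cong_0_iff dest: dvd_imp_le)
    qed
  qed
qed simp

text \<open>The intermediate lengths are the numbers \<open>k * b ^ e\<close> with \<open>1 \<le> k < b\<close>, in increasing order.
  A pseudopalindrome that extends the prefix of length \<open>k * b ^ e + 1\<close> and is shorter than
  \<open>(k + 1) * b ^ e\<close> would reflect the end of this prefix onto itself. The prefix of length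
  \<open>k * b ^ e\<close> is itself symmetric under the reflection whose constant is smaller by one, and
  the two symmetries together give a shifted copy of a prefix as in
  \<open>no_shifted_prefix_at_end\<close>.\<close>

lemma thue_morse_small_base_pseudostandard:
  assumes b: "b > 1" and bm: "b \<le> m"
  shows "generalized_pseudostandard {0..<m} (thue_morse b m)"
proof -
  \<comment> \<open>With \<open>p = e * (b - 1) + (k - 1)\<close>, the entry at \<open>p + 1\<close> is \<open>k * b ^ e\<close>, so that the prefix of
    this length is fixed by the reflection with constant \<open>p\<close>.\<close>
  define len where "len n = (case n of 0 \<Rightarrow> 0 | Suc n \<Rightarrow> Suc (n mod (b - 1)) * b ^ (n div (b - 1)))" for n
  have len_Suc: "len (Suc n) = Suc (n mod (b - 1)) * b ^ (n div (b - 1))" for n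
    by (simp add: len_def)
  have m: "m > 1" using assms by simp
  have step: "\<exists>k e. 0 < k \<and> k < b \<and> n = e * (b - 1) + k \<and> len n = k * b ^ e \<and>
      len (Suc n) = Suc k * b ^ e" if pos: "n > 0" for n
  proof -
    obtain p where p: "n = Suc p" using pos by (cases n) auto
    define k e where "k = Suc (p mod (b - 1))" and "e = p div (b - 1)"
    have k: "k < b" using b mod_less_divisor[of "b - 1" p] unfolding k_def by linarith
    have n: "n = e * (b - 1) + k"
      unfolding p k_def e_def using div_mult_mod_eq[of p "b - 1"] by linarith
    have "len (Suc n) = Suc k * b ^ e"
    proof (cases "k = b - 1")
      case True
      then have n': "n = Suc e * (b - 1)" using n by simp
      have "n div (b - 1) = Suc e" unfolding n' using b by (intro nonzero_mult_div_cancel_right) simp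
      moreover have "n mod (b - 1) = 0" unfolding n' by (rule mod_mult_self2_is_0)
      moreover have "Suc k = b" using True b by simp
      ultimately show ?thesis by (simp add: len_Suc)
    next
      case False
      then have "k < b - 1" using k by simp
      then have "n div (b - 1) = e" "n mod (b - 1) = k" by (simp_all add: n)
      then show ?thesis by (simp add: len_Suc)
    qed
    moreover have "len n = k * b ^ e" "0 < k" by (simp_all add: p len_def k_def e_def)
    ultimately show ?thesis using k n by blast
  qed
  show ?thesis
  proof (rule generalized_pseudostandardI[where
        \<Theta> = "\<lambda>n w. rev (map (reflection m n) w)" and len = len])
    show "len n < len (Suc n)" for n
      using step[of n] b by (cases "n = 0") (auto simp: len_def)
    show "pseudopalindrome {0..<m} (\<lambda>w. rev (map (reflection m n) w))
        (map (thue_morse b m) [0..<len (Suc n)])" for n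
    proof (rule thue_morse_prefix_pal)
      fix i assume i: "i < len (Suc n)"
      define k e where "k = Suc (n mod (b - 1))" and "e = n div (b - 1)"
      have "0 < k" "k \<le> b" using b mod_less_divisor[of "b - 1" n] unfolding k_def by linarith+
      moreover have "len (Suc n) = k * b ^ e" by (simp add: len_def k_def e_def)
      moreover have "n = e * (b - 1) + (k - 1)"
        unfolding k_def e_def using div_mult_mod_eq[of n "b - 1"] by linarith
      ultimately show "[digit_sum b (len (Suc n) - 1 - i) + digit_sum b i = n] (mod m)"
        using digit_sum_complement[OF b, of k i e] i by (simp add: add.commute)
    qed (use m in simp)
    show "len (Suc n) \<le> length v"
      if v: "pseudopalindrome {0..<m} (\<lambda>w. rev (map (reflection m n) w)) v"
        "prefix (map (thue_morse b m) [0..<Suc (len n)]) v" for n v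
    proof (cases "n = 0")
      case True
      then show ?thesis using prefix_length_le[OF v(2)] by (simp add: len_def)
    next
      case False
      then obtain k e where k: "0 < k" "k < b" and n: "n = e * (b - 1) + k"
        and l: "len n = k * b ^ e" "len (Suc n) = Suc k * b ^ e"
        using step by blast
      have l0: "b ^ e \<le> len n" using k by (simp add: l)
      show ?thesis
      proof (rule ccontr)
        assume short: "\<not> ?thesis"
        have long: "Suc (len n) \<le> length v" using prefix_length_le[OF v(2)] by simp
        have vn: "v ! j = thue_morse b m j" if "j \<le> len n" for j
        proof -
          have "v ! j = map (thue_morse b m) [0..<Suc (len n)] ! j"
            using v(2) that by (auto simp: prefix_def nth_append simp del: upt_Suc)
          then show ?thesis using that by (simp del: upt_Suc)
        qed
        \<comment> \<open>The symmetry of \<open>v\<close> sends the last position \<open>len n\<close> of the given prefix to \<open>c - 1\<close>.\<close>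
        define c where "c = length v - len n"
        have c: "0 < c" "c < b ^ e" using long short by (simp_all add: c_def l)
        show False
        proof (rule no_shifted_prefix_at_end[OF b bm c])
          fix r assume r: "r \<le> b ^ e - c"
          have lv: "length v = len n + c" using long by (simp add: c_def)
          have rl: "c + r \<le> len n" "c + r < length v" "r < len n"
            using r c l0 lv by linarith+
          then have "r < k * b ^ e" by (simp add: l)
          have "length v - 1 - (c + r) = len n - 1 - r" using long by (simp add: c_def)
          then have "[v ! (len n - 1 - r) + v ! (c + r) = n] (mod m)"
            using v(1) rl(2) unfolding pseudopalindrome_reflection_iff by metis
          then have "[digit_sum b (c + r) + digit_sum b (len n - 1 - r) = n] (mod m)"
            using rl by (simp add: vn thue_morse_def cong_def mod_add_eq add.commute)
          moreover have "n = 1 + digit_sum b r + digit_sum b (len n - 1 - r)"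
            using digit_sum_complement[OF b k(1) less_imp_le[OF k(2)] \<open>r < k * b ^ e\<close>] n k
            unfolding l(1) by linarith
          ultimately show "[digit_sum b (c + r) = 1 + digit_sum b r] (mod m)"
            by (metis cong_add_rcancel_nat)
        qed
      qed
    qed
  qed (use m in \<open>auto simp: len_def intro: involutory_antimorphism_reflection thue_morse_less\<close>)
qed

section \<open>Necessity\<close>

text \<open>What remains of pseudopalindromicity when the letter map is forgotten: reversal sends equal
  letters to equal letters. This survives division of the length by \<open>b\<close>, which changes the letter
  map by a constant.\<close>

definition mirrored :: "(nat \<Rightarrow> 'a) \<Rightarrow> nat \<Rightarrow> bool" where
  "mirrored u L \<longleftrightarrow> (\<forall>i<L. \<forall>j<L. u i = u j \<longrightarrow> u (L - 1 - i) = u (L - 1 - j))"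

lemma mirrored_iff:
  assumes "mirrored u L" "i < L" "j < L"
  shows "u (L - 1 - i) = u (L - 1 - j) \<longleftrightarrow> u i = u j"
proof
  assume "u (L - 1 - i) = u (L - 1 - j)"
  moreover have "L - 1 - i < L" "L - 1 - j < L" using assms(2,3) by simp_all
  ultimately have "u (L - 1 - (L - 1 - i)) = u (L - 1 - (L - 1 - j))"
    using assms(1) unfolding mirrored_def by blast
  then show "u i = u j" using assms(2,3) by simp
qed (use assms in \<open>unfold mirrored_def, blast\<close>)

lemma pseudopalindromic_prefixD:
  assumes "involutory_antimorphism A \<Psi>" "pseudopalindrome A \<Psi> (map u [0..<L])" "i < L"
  shows "letter_map \<Psi> (u (L - 1 - i)) = u i"
proof -
  have "L - 1 - i < L" using assms(3) by simp
  then show ?thesis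
    using assms(2,3) unfolding pseudopalindrome_iff[OF assms(1)] by (simp del: upt_Suc)
qed

lemma pseudopalindrome_imp_mirrored:
  assumes "involutory_antimorphism A \<Psi>" "pseudopalindrome A \<Psi> (map u [0..<L])"
  shows "mirrored u L"
  unfolding mirrored_def
proof (intro allI impI)
  fix i j assume ij: "i < L" "j < L" "u i = u j"
  have "u (L - 1 - i) = letter_map \<Psi> (u i)" if "i < L" for i
    using pseudopalindromic_prefixD[OF assms, of "L - 1 - i"] that by simp
  then show "u (L - 1 - i) = u (L - 1 - j)" using ij by metis
qed

text \<open>Compare letters at distance \<open>m\<close>. Without a carry they agree; but \<open>b - m\<close> and \<open>b\<close> carry
  different letters, because \<open>m\<close> does not divide \<open>b - 1\<close>, while \<open>b - m - 1\<close> and \<open>b - 1\<close> carry the same.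
  The mirror images are a pair \<open>p, p + m\<close> with different letters and the next pair
  \<open>p + 1, p + 1 + m\<close> with equal letters, where \<open>p + 1 = L - b\<close>. If \<open>b\<close> did not divide \<open>p + 1\<close>, either
  there would be no carry from \<open>p\<close> to \<open>p + m\<close>, or the second pair would arise from the first
  by adding \<open>1\<close> to both letters; both are impossible.\<close>

lemma thue_morse_mirrored_dvd:
  assumes b: "b > 1" and m: "0 < m" "m < b" and nc: "\<not> [b - 1 = 0] (mod m)"
    and L: "b < L" and mir: "mirrored (thue_morse b m) L"
  shows "b dvd L"
proof -
  let ?t = "thue_morse b m"
  define p where "p = L - 1 - b"
  have p: "L = p + 1 + b" using L by (simp add: p_def)
  have cong_m: "[x = x + m] (mod m)" for x by (simp add: cong_def)
  have "?t (b - m) \<noteq> ?t b"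
  proof
    assume "?t (b - m) = ?t b"
    then have "[b - m = 1] (mod m)"
      using b m digit_sum_mult[of b 1] by (simp add: thue_morse_eq_iff digit_sum_digit)
    then have "[b - m + m = 1] (mod m)" by (simp add: cong_def)
    then have "[b - 1 + 1 = 0 + 1] (mod m)" using m by simp
    then show False using nc by (simp only: cong_add_rcancel_nat)
  qed
  moreover have "L - 1 - (b - m) = p + m" "L - 1 - b = p" using m by (simp_all add: p)
  ultimately have neq: "?t p \<noteq> ?t (p + m)"
    using mirrored_iff[OF mir, of "b - m" b] L m less_imp_diff_less[of b L m] by simp
  have "?t (b - 1 - m) = ?t (b - 1)"
    using b m cong_m[of "b - 1 - m"] by (simp add: thue_morse_eq_iff digit_sum_digit)
  moreover have "L - 1 - (b - 1 - m) = p + 1 + m" "L - 1 - (b - 1) = p + 1"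
    using m by (simp_all add: p)
  ultimately have eq: "?t (p + 1) = ?t (p + 1 + m)"
    using mirrored_iff[OF mir, of "b - 1 - m" "b - 1"] L m by simp
  have "b dvd p + 1"
  proof (rule ccontr)
    assume "\<not> b dvd p + 1"
    define a d where "a = (p + 1) div b" and "d = (p + 1) mod b"
    have d: "0 < d" "d < b" and p1: "p + 1 = a * b + d"
      using \<open>\<not> b dvd p + 1\<close> b by (simp_all add: a_def d_def dvd_eq_mod_eq_0)
    have p0: "p = a * b + (d - 1)" using p1 d by linarith
    show False
    proof (cases "d + m \<le> b")
      case True
      have "p + m = a * b + (d - 1 + m)" using p0 by simp
      then have "digit_sum b (p + m) = digit_sum b p + m"
        using digit_sum_mult_add[OF b, of "d - 1 + m" a] digit_sum_mult_add[OF b, of "d - 1" a]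
          True d p0 by simp
      then have "[digit_sum b p = digit_sum b (p + m)] (mod m)" using cong_m by metis
      then show False using neq unfolding thue_morse_eq_iff by blast
    next
      case False
      have "p + m = Suc a * b + (d - 1 + m - b)" "p + 1 + m = Suc a * b + (d + m - b)"
        using False p0 p1 d by simp_all
      then have "digit_sum b (p + 1 + m) = digit_sum b (p + m) + 1"
        using digit_sum_mult_add[OF b, of "d - 1 + m - b" "Suc a"]
          digit_sum_mult_add[OF b, of "d + m - b" "Suc a"] False d m by simp
      moreover have "digit_sum b (p + 1) = digit_sum b p + 1"
        using digit_sum_mult_add[OF b, of "d - 1" a] digit_sum_mult_add[OF b, of d a] d p0 p1
        by simp
      ultimately have "[digit_sum b p + 1 = digit_sum b (p + m) + 1] (mod m)"
        using eq by (simp add: thue_morse_eq_iff)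
      then show False using neq unfolding cong_add_rcancel_nat thue_morse_eq_iff by blast
    qed
  qed
  then show ?thesis unfolding p by (rule dvd_add) simp
qed

lemma thue_morse_mirrored_div:
  assumes b: "b > 1" and mir: "mirrored (thue_morse b m) (L * b)"
  shows "mirrored (thue_morse b m) L"
  unfolding mirrored_def
proof (intro allI impI)
  fix i j assume ij: "i < L" "j < L" "thue_morse b m i = thue_morse b m j"
  have *: "digit_sum b (L * b - 1 - i * b) = digit_sum b (L - 1 - i) + (b - 1)" if "i < L" for i
  proof -
    define x where "x = L - 1 - i"
    have x: "L = i + x + 1" using that by (simp add: x_def)
    have "L * b - 1 - i * b = x * b + (b - 1)" using b by (simp add: x algebra_simps)
    then show ?thesis using digit_sum_mult_add[OF b, of "b - 1" x] b by (simp add: x)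
  qed
  have "thue_morse b m (i * b) = thue_morse b m (j * b)"
    using ij(3) b by (simp add: thue_morse_def digit_sum_mult)
  then have "thue_morse b m (L * b - 1 - i * b) = thue_morse b m (L * b - 1 - j * b)"
    using mir ij b unfolding mirrored_def by simp
  then show "thue_morse b m (L - 1 - i) = thue_morse b m (L - 1 - j)"
    using *[OF ij(1)] *[OF ij(2)] by (simp add: thue_morse_eq_iff cong_add_rcancel_nat)
qed

text \<open>Dividing by \<open>b\<close> as long as possible leads to a length in \<open>{1<..2}\<close>.\<close>

lemma thue_morse_mirrored_length:
  assumes b: "b > 1" and m: "0 < m" "m < b" and nc: "\<not> [b - 1 = 0] (mod m)"
    and "mirrored (thue_morse b m) L" "b ^ N < L" "L \<le> 2 * b ^ N"
  shows "L = 2 * b ^ N"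
  using assms(5-)
proof (induction N arbitrary: L)
  case (Suc N)
  have "b \<le> b ^ Suc N" using b by simp
  then have "b dvd L"
    using thue_morse_mirrored_dvd[OF b m nc _ Suc.prems(1)] Suc.prems(2) by linarith
  then obtain K where K: "L = K * b" by (metis dvd_mult_div_cancel mult.commute)
  have "mirrored (thue_morse b m) K"
    using thue_morse_mirrored_div[OF b] Suc.prems(1) K by blast
  moreover have "b ^ N < K" "K \<le> 2 * b ^ N" using Suc.prems(2,3) b by (auto simp: K mult.commute)
  ultimately show ?case using Suc.IH[of K] by (simp add: K)
qed simp

text \<open>The closure step that passes the length \<open>B = b ^ m\<close> has to end at \<open>2 * B\<close>, and with the
  reflection \<open>x \<mapsto> 1 - x\<close>. A strictly shorter pseudopalindrome for the same reflection contradicts the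
  minimality of the closure.\<close>

lemma thue_morse_not_pseudostandard:
  assumes m: "m > 1" "m < b" and nc: "\<not> [b - 1 = 0] (mod m)"
  shows "\<not> generalized_pseudostandard {0..<m} (thue_morse b m)"
proof
  let ?A = "{0..<m}" and ?t = "thue_morse b m"
  assume "generalized_pseudostandard ?A ?t"
  then obtain \<Theta> \<Delta> where \<Theta>: "\<forall>n. involutory_antimorphism ?A (\<Theta> n)"
    and \<Delta>: "\<forall>n. \<Delta> n \<in> ?A" and t: "?t = pseudostandard_word ?A \<Theta> \<Delta>"
    unfolding generalized_pseudostandard_def by blast
  let ?w = "pseudostandard_prefix ?A \<Theta> \<Delta>"
  have b: "b > 1" using m by simp
  have tA: "?t i \<in> ?A" for i using m by (simp add: thue_morse_less)
  have pre: "?w n = map ?t [0..<length (?w n)]" for n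
    using theI'[OF pseudostandard_word_ex1[OF \<Theta> \<Delta>]]
    unfolding t pseudostandard_word_def prefix_of_infinite_def by blast
  have wA: "?w n \<in> lists ?A" for n by (subst pre) (use tA in auto)
  have clA: "?w n @ [\<Delta> n] \<in> lists ?A" for n using wA[of n] \<Delta> by simp
  note cl = pal_closure_props[OF spec[OF \<Theta>] clA]
  have grow: "length (?w n) < length (?w (Suc n))" for n
    using prefix_length_le[OF cl(2)[of n n]] by simp
  have len: "n \<le> length (?w n)" for n
  proof (induction n)
    case (Suc n)
    then show ?case using grow[of n] by linarith
  qed simp
  \<comment> \<open>The exponent makes the digit sum \<open>m * (b - 1)\<close> of \<open>B - 1\<close> vanish modulo \<open>m\<close>.\<close>
  define B where "B = b ^ m"
  have bB: "b \<le> B" unfolding B_def using b m by (simp add: self_le_power)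
  have bdB: "b dvd B" unfolding B_def using m by simp
  obtain n where n: "length (?w n) \<le> B" "B < length (?w (Suc n))"
  proof -
    have "B < length (?w (Suc B))" using len[of "Suc B"] by linarith
    then obtain k where k: "B < length (?w k)" "\<forall>i<k. \<not> B < length (?w i)"
      using exists_least_iff[of "\<lambda>k. B < length (?w k)"] by blast
    have "k \<noteq> 0" using k(1) by (intro notI) simp
    moreover from this have "\<not> B < length (?w (k - 1))" using k(2) by simp
    ultimately show ?thesis using that[of "k - 1"] k(1) by simp
  qed
  let ?\<Psi> = "\<Theta> n"
  define L where "L = length (?w (Suc n))"
  note \<Psi> = spec[OF \<Theta>, of n]
  have pal: "pseudopalindrome ?A ?\<Psi> (map ?t [0..<L])"
    using cl(1)[of n n] pre[of "Suc n"] by (simp add: L_def)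
  have mir: "mirrored ?t L" by (rule pseudopalindrome_imp_mirrored[OF \<Psi> pal])
  have clos: "L \<le> length v" if "pseudopalindrome ?A ?\<Psi> v" "prefix (?w n @ [\<Delta> n]) v" for v
    using cl(3)[OF that] by (simp add: L_def)
  have app: "?\<Psi> (x @ y) = ?\<Psi> y @ ?\<Psi> x" if "x \<in> lists ?A" "y \<in> lists ?A" for x y
    using \<Psi> that unfolding involutory_antimorphism_def by blast
  have inv: "?\<Psi> x \<in> lists ?A" "?\<Psi> (?\<Psi> x) = x" if "x \<in> lists ?A" for x
    using \<Psi> that unfolding involutory_antimorphism_def by blast+
  have L2: "L = 2 * B"
  proof -
    let ?x = "?w n @ [\<Delta> n]"
    have "pseudopalindrome ?A ?\<Psi> (?x @ ?\<Psi> ?x)"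
      using inv[OF clA[of n]] app[OF clA[of n] inv(1)[OF clA[of n]]] clA[of n]
      by (simp only: pseudopalindrome_def append_in_lists_conv)
    then have "L \<le> 2 * B + 2"
      using clos[of "?x @ ?\<Psi> ?x"] length_antimorphism[OF \<Psi> clA] n(1) by simp
    moreover have "b dvd L"
      using thue_morse_mirrored_dvd[OF b _ m(2) nc _ mir] n(2) bB m by (simp add: L_def)
    ultimately have "L \<le> 2 * B"
    proof -
      assume "L \<le> 2 * B + 2" "b dvd L"
      then have "L - 2 * B \<le> 2" "b dvd L - 2 * B" using bdB by simp_all
      then have "L - 2 * B = 0" using m dvd_imp_le[of b "L - 2 * B"] by linarith
      then show ?thesis by simp
    qed
    then show ?thesis
      using thue_morse_mirrored_length[OF b _ m(2) nc mir, of m] n(2) m by (simp add: B_def L_def)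
  qed
  have sB: "digit_sum b (B - 1 - j) + digit_sum b j = m * (b - 1)" if "j < B" for j
    using digit_sum_complement[OF b, of 1 j m] that b by (simp add: B_def add.commute)
  have sB': "digit_sum b (B + j) = 1 + digit_sum b j" if "j < B" for j
    using digit_sum_power_add[OF b, of j m 1] that b by (simp add: B_def digit_sum_digit)
  have psi: "letter_map ?\<Psi> x = y" if x: "x < m" and y: "y < m" and xy: "[x + y = 1] (mod m)" for x y
  proof -
    \<comment> \<open>Every letter \<open>x\<close> occurs among the last \<open>m\<close> letters of the prefix of length \<open>B\<close>, where
      \<open>t (B - 1 - j)\<close> is \<open>- j\<close>; its mirror image is \<open>t (B + j)\<close>, which is \<open>1 + j\<close>,
      both modulo \<open>m\<close>.\<close>
    define j where "j = (if x = 0 then 0 else m - x)"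
    have j: "j < m" "[x + j = 0] (mod m)" using x by (auto simp: j_def cong_def)
    then have jB: "j < B" using bB m by simp
    have s: "digit_sum b j = j" using j m by (simp add: digit_sum_digit)
    have "[digit_sum b (B - 1 - j) + j = x + j] (mod m)"
      using sB[OF jB] j(2) s by (simp add: cong_def)
    then have "[digit_sum b (B - 1 - j) = x] (mod m)" by (simp only: cong_add_rcancel_nat)
    then have "?t (B - 1 - j) = x" using x by (simp add: thue_morse_def cong_def)
    moreover have "[x + y = x + (1 + j)] (mod m)"
      using xy cong_add_lcancel_nat[of 1 "x + j" 0 m] j(2)
      by (metis add.left_commute add.right_neutral cong_sym cong_trans)
    then have "[y = 1 + j] (mod m)" by (simp only: cong_add_lcancel_nat)
    then have "?t (B + j) = y" using sB'[OF jB] s y by (simp add: thue_morse_def cong_def)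
    moreover have "L - 1 - (B + j) = B - 1 - j" by (simp add: L2)
    moreover have "letter_map ?\<Psi> (?t (L - 1 - (B + j))) = ?t (B + j)"
      using jB by (intro pseudopalindromic_prefixD[OF \<Psi> pal]) (simp add: L2)
    ultimately show ?thesis by simp
  qed
  \<comment> \<open>\<open>q\<close> spells \<open>0 1 \<dots> m-1 0 1\<close> and \<open>u @ q\<close> is the prefix of length \<open>B + 1\<close>.\<close>
  define q where "q = map ?t [B - 1 - m..<B + 1]"
  define u where "u = map ?t [0..<B - 1 - m]"
  have mB: "m < B" using m bB by simp
  have lq: "length q = m + 2" using mB by (simp add: q_def)
  have qi: "[q ! i = i] (mod m)" if "i < m + 2" for i
  proof -
    have qi: "q ! i = ?t (B - 1 - m + i)" using that mB by (simp add: q_def del: upt_Suc)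
    show ?thesis
    proof (cases "i \<le> m")
      case True
      have "B - 1 - m + i = B - 1 - (m - i)" using True mB by simp
      moreover have "digit_sum b (B - 1 - (m - i)) + digit_sum b (m - i) = m * (b - 1)"
        using mB by (intro sB) simp
      moreover have "digit_sum b (m - i) = m - i" using m by (intro digit_sum_digit[OF b]) simp
      ultimately have "digit_sum b (B - 1 - m + i) + (m - i) = m * (b - 1)" by (simp only:)
      then have "[digit_sum b (B - 1 - m + i) + (m - i) = i + (m - i)] (mod m)"
        using True by (simp add: cong_def)
      then have "[digit_sum b (B - 1 - m + i) = i] (mod m)" by (simp only: cong_add_rcancel_nat)
      then show ?thesis by (simp add: qi thue_morse_def cong_def)
    next
      case False
      then have i: "i = 1 + m" using that by simp
      then have "B - 1 - m + i = B" using mB by simp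
      moreover have "digit_sum b B = 1" using sB'[of 0] mB by simp
      ultimately have "q ! i = 1 mod m" by (simp only: qi thue_morse_def)
      then show ?thesis unfolding cong_def i by (simp only: mod_mod_trivial mod_add_self2)
    qed
  qed
  have uA: "u \<in> lists ?A" and qA: "q \<in> lists ?A" using tA by (auto simp: u_def q_def)
  have palq: "pseudopalindrome ?A ?\<Psi> q"
    unfolding pseudopalindrome_iff[OF \<Psi>]
  proof (intro conjI allI impI qA)
    fix i assume i: "i < length q"
    have "[q ! (length q - 1 - i) + q ! i = m + 1 - i + i] (mod m)"
      using i by (intro cong_add qi) (simp_all add: lq qi)
    moreover have "m + 1 - i + i = 1 + m" using i by (simp add: lq)
    ultimately have "[q ! (length q - 1 - i) + q ! i = 1] (mod m)"
      unfolding cong_def by (simp only: mod_add_self2)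
    moreover have "q ! j < m" if "j < length q" for j using that qA nth_mem by fastforce
    ultimately show "letter_map ?\<Psi> (q ! (length q - 1 - i)) = q ! i" using i by (intro psi) auto
  qed
  have "pseudopalindrome ?A ?\<Psi> (u @ q @ ?\<Psi> u)"
    using uA qA inv palq app[of u "q @ ?\<Psi> u"] app[of q "?\<Psi> u"]
    by (simp add: pseudopalindrome_def)
  moreover have "prefix (?w n @ [\<Delta> n]) (u @ q @ ?\<Psi> u)"
  proof -
    have uq: "u @ q = map ?t [0..<B + 1]"
      using upt_add_eq_append[of 0 "B - 1 - m" "m + 2"] mB unfolding u_def q_def
      by (simp add: map_append[symmetric] del: map_append upt_Suc)
    have "prefix (?w n @ [\<Delta> n]) (map ?t [0..<L])"
      using cl(2)[of n n] pre[of "Suc n"] by (simp add: L_def)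
    moreover have "prefix (u @ q) (map ?t [0..<L])"
      unfolding uq L2 using mB by (intro prefix_map_upt) simp
    moreover have "length (?w n @ [\<Delta> n]) \<le> length (u @ q)" unfolding uq using n(1) by simp
    ultimately have "prefix (?w n @ [\<Delta> n]) (u @ q)" by (rule prefix_length_prefix)
    then show ?thesis by (metis append.assoc prefix_prefix)
  qed
  ultimately have "L \<le> length (u @ q @ ?\<Psi> u)" by (rule clos)
  then show False using length_antimorphism[OF \<Psi> uA] mB m by (simp add: L2 lq) (simp add: u_def)
qed

theorem theorem1p1:
  fixes b m :: nat
  assumes "b > 1" and "m > 1"
  shows "generalized_pseudostandard {0..<m} (thue_morse b m) \<longleftrightarrow>
    b \<le> m \<or> [b - 1 = 0] (mod m)"
  using assms thue_morse_not_pseudostandard thue_morse_small_base_pseudostandard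
    thue_morse_periodic_pseudostandard by (meson not_le)

end
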